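(* Let $(X,G)$ be a topological dynamical system and let $m\in\mathbb{N}$. (i) If $(X,G)$ is transitive, then it is either almost diam-mean $m$-equicontinuous or diam-mean $m$-sensitive. (ii) If $(X,G)$ is minimal, then it is either diam-mean $m$-equicontinuous or diam-mean $m$-sensitive.
   Context: A topological dynamical system (tds) $(X,G)$ consists of a compact metric space $X$ with metric $d$ and a countably infinite discrete amenable group $G$ acting on $X$ by homeomorphisms; the action is written $x\mapsto gx$, and $gU=g(U)=\{gx : x\in U\}$. The tds is transitive if some point has a dense orbit, and minimal if all orbits are dense. $\mathbb{N}=\{1,2,\dots\}$. A Følner sequence is a sequence $\mathcal{F}=(\mathcal{F}_n)_{n\in\mathbb{N}}$ of nonempty finite subsets of $G$ with $\lim_{n\to\infty}|\mathcal{F}_n\triangle K\mathcal{F}_n|/|\mathcal{F}_n|=0$ for every nonempty finite $K\subseteq G$. The symbol $\sup_{\mathcal{F}}$ denotes the supremum over all Følner sequences of $G$. For $x_1,\dots,x_m\in X$ let $D_m(x_1,\dots,x_m)=\min_{1\le i<j\le m}d(x_i,x_j)$, and for $A\subseteq X$ let $\mathrm{Diam}_m(A)=\sup\{D_m(x_1,\dots,x_m) : (x_1,\dots,x_m)\in A^m\}$. Conventions: $\min\emptyset=+\infty$ (relevant only for $m=1$), $\mathrm{Diam}_m(\emptyset)=0$. $\mathrm{Diam}(A)$ denotes the usual diameter of $A$. For $U\subseteq X$ put $S_m(U)=\sup_{\mathcal{F}}\limsup_{n\to\infty}\frac{1}{|\mathcal{F}_n|}\sum_{g\in\mathcal{F}_n}\mathrm{Diam}_m(gU)$.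 $(X,G)$ is diam-mean $m$-equicontinuous if for every $\varepsilon>0$ there is $\delta>0$ such that $S_m(U)<\varepsilon$ for all $U\subseteq X$ with $\mathrm{Diam}(U)<\delta$. A point $x\in X$ is a diam-mean $m$-equicontinuity point if for every $\varepsilon>0$ there is $\delta>0$ such that $S_m(U)<\varepsilon$ for all open neighbourhoods $U$ of $x$ with $\mathrm{Diam}(U)<\delta$. $(X,G)$ is almost diam-mean $m$-equicontinuous if the set of diam-mean $m$-equicontinuity points is residual in $X$. $(X,G)$ is diam-mean $m$-sensitive if there is $\varepsilon>0$ such that $S_m(U)\ge\varepsilon$ for every nonempty open $U\subseteq X$. "Either ... or" means that exactly one of the two alternatives holds. *)

theory Defs
  imports "HOL-Analysis.Analysis" "HOL-Algebra.Group_Action"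
begin

text \<open>
  The phase space is the whole type \<open>'x\<close>, with the metric of its type class; it is
  therefore nonempty.  The acting group is a \<open>HOL-Algebra\<close> group, and \<open>\<phi> g x\<close> stands
  for \<open>gx\<close>.
\<close>

definition folner_sequence :: "('g, 'b) monoid_scheme \<Rightarrow> (nat \<Rightarrow> 'g set) \<Rightarrow> bool" where
  "folner_sequence G F \<longleftrightarrow>
     (\<forall>n. F n \<noteq> {} \<and> finite (F n) \<and> F n \<subseteq> carrier G) \<and>
     (\<forall>K. K \<noteq> {} \<and> finite K \<and> K \<subseteq> carrier G \<longrightarrow>
        (\<lambda>n. real (card (sym_diff (F n) (K <#>\<^bsub>G\<^esub> F n))) / real (card (F n))) \<longlonglongrightarrow> 0)"

text \<open>For countable discrete groups, amenability is existence of a Folner sequence.\<close>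

definition amenable :: "('g, 'b) monoid_scheme \<Rightarrow> bool" where
  "amenable G \<longleftrightarrow> (\<exists>F. folner_sequence G F)"

locale tds = group_action G "UNIV :: 'x set" \<phi>
  for G :: "('g, 'b) monoid_scheme" (structure)
    and \<phi> :: "'g \<Rightarrow> 'x::metric_space \<Rightarrow> 'x" +
  assumes compact_space: "compact (UNIV :: 'x set)"
    and countable_group: "countable (carrier G)"
    and infinite_group: "infinite (carrier G)"
    and amenable_group: "amenable G"
    and homeomorphism_action:
      "g \<in> carrier G \<Longrightarrow> homeomorphism UNIV UNIV (\<phi> g) (\<phi> (inv g))"

definition tds_transitive ::
  "('g, 'b) monoid_scheme \<Rightarrow> ('g \<Rightarrow> 'x::metric_space \<Rightarrow> 'x) \<Rightarrow> bool" where
  "tds_transitive G \<phi> \<longleftrightarrow> (\<exists>x. closure (orbit G \<phi> x) = UNIV)"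

definition tds_minimal ::
  "('g, 'b) monoid_scheme \<Rightarrow> ('g \<Rightarrow> 'x::metric_space \<Rightarrow> 'x) \<Rightarrow> bool" where
  "tds_minimal G \<phi> \<longleftrightarrow> (\<forall>x. closure (orbit G \<phi> x) = UNIV)"

text \<open>
  Values are taken in \<open>ennreal\<close>, where the infimum of the empty set is \<open>\<infinity>\<close> and the
  supremum of the empty set is \<open>0\<close>.  So \<open>min_dist 1 x = \<infinity>\<close>, and, for \<open>m \<ge> 1\<close>,
  \<open>Diam_m m {} = 0\<close>.  An \<open>m\<close>-tuple is a function on \<open>nat\<close> of which only the values on
  \<open>{1..m}\<close> matter.
\<close>

definition min_dist :: "nat \<Rightarrow> (nat \<Rightarrow> 'x::metric_space) \<Rightarrow> ennreal" where
  "min_dist m x = (INF (i, j)\<in>{(i, j). 1 \<le> i \<and> i < j \<and> j \<le> m}. ennreal (dist (x i) (x j)))"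

definition Diam_m :: "nat \<Rightarrow> 'x::metric_space set \<Rightarrow> ennreal" where
  "Diam_m m A = (SUP x\<in>{1..m} \<rightarrow> A. min_dist m x)"

definition S_m ::
  "('g, 'b) monoid_scheme \<Rightarrow> ('g \<Rightarrow> 'x::metric_space \<Rightarrow> 'x) \<Rightarrow> nat \<Rightarrow> 'x set \<Rightarrow> ennreal" where
  "S_m G \<phi> m U =
     (SUP F\<in>{F. folner_sequence G F}.
        limsup (\<lambda>n. (\<Sum>g\<in>F n. Diam_m m (\<phi> g ` U)) / of_nat (card (F n))))"

definition diam_mean_equicontinuous ::
  "('g, 'b) monoid_scheme \<Rightarrow> ('g \<Rightarrow> 'x::metric_space \<Rightarrow> 'x) \<Rightarrow> nat \<Rightarrow> bool" where
  "diam_mean_equicontinuous G \<phi> m \<longleftrightarrow>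
     (\<forall>\<epsilon>::real>0. \<exists>\<delta>>0. \<forall>U. diameter U < \<delta> \<longrightarrow> S_m G \<phi> m U < ennreal \<epsilon>)"

definition diam_mean_equicontinuity_point ::
  "('g, 'b) monoid_scheme \<Rightarrow> ('g \<Rightarrow> 'x::metric_space \<Rightarrow> 'x) \<Rightarrow> nat \<Rightarrow> 'x \<Rightarrow> bool" where
  "diam_mean_equicontinuity_point G \<phi> m x \<longleftrightarrow>
     (\<forall>\<epsilon>::real>0. \<exists>\<delta>>0. \<forall>U. open U \<and> x \<in> U \<and> diameter U < \<delta> \<longrightarrow> S_m G \<phi> m U < ennreal \<epsilon>)"

definition residual_set :: "'x::topological_space set \<Rightarrow> bool" where
  "residual_set A \<longleftrightarrow>
     (\<exists>\<V>. countable \<V> \<and> (\<forall>V\<in>\<V>. open V \<and> closure V = UNIV) \<and> \<Inter>\<V> \<subseteq> A)"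

definition almost_diam_mean_equicontinuous ::
  "('g, 'b) monoid_scheme \<Rightarrow> ('g \<Rightarrow> 'x::metric_space \<Rightarrow> 'x) \<Rightarrow> nat \<Rightarrow> bool" where
  "almost_diam_mean_equicontinuous G \<phi> m \<longleftrightarrow>
     residual_set {x. diam_mean_equicontinuity_point G \<phi> m x}"

definition diam_mean_sensitive ::
  "('g, 'b) monoid_scheme \<Rightarrow> ('g \<Rightarrow> 'x::metric_space \<Rightarrow> 'x) \<Rightarrow> nat \<Rightarrow> bool" where
  "diam_mean_sensitive G \<phi> m \<longleftrightarrow>
     (\<exists>\<epsilon>::real>0. \<forall>U. open U \<and> U \<noteq> {} \<longrightarrow> S_m G \<phi> m U \<ge> ennreal \<epsilon>)"

end

theory Submission
  imports Defs
begin

text \<open>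
  For \<open>\<epsilon> > 0\<close> let \<open>W \<epsilon>\<close> be the union of all open sets \<open>U\<close> with \<open>S_m U < \<epsilon>\<close>.  The whole
  dichotomy is about these open sets: the system fails to be sensitive exactly when
  every \<open>W \<epsilon>\<close> is nonempty, and, since \<open>S_m\<close> is monotone, the intersection of all \<open>W \<epsilon>\<close> is the
  set of equicontinuity points.

  The essential point is that \<open>W \<epsilon>\<close> is invariant under the action.  Replacing \<open>U\<close> by
  \<open>hU\<close> changes the averages over \<open>F n\<close> into averages over the right translates
  \<open>F n h\<close>.  As the Folner condition concerns translation from the left, the right
  translates form a Folner sequence again, with the same ratios; and \<open>S_m\<close> is a
  supremum over all Folner sequences, so \<open>S_m (hU) = S_m U\<close>.

  A nonempty open invariant set meets, hence contains, every dense orbit.  In a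
  transitive system a nonempty \<open>W \<epsilon>\<close> is therefore dense, and without sensitivity the
  dense open sets \<open>W (1/n)\<close> exhibit the set of equicontinuity points as residual.  In a
  minimal system a nonempty \<open>W \<epsilon>\<close> is everything, and a Lebesgue number of the cover by
  the sets \<open>U\<close> is the \<open>\<delta>\<close> required by equicontinuity.

  The alternatives exclude each other because sensitivity empties some \<open>W \<epsilon>\<close> and so
  rules out even a single equicontinuity point, whereas a residual set in a nonempty
  compact space contains a point by Baire's theorem.
\<close>

section \<open>Monotonicity\<close>

lemma diameter_ball_less:
  fixes x :: "'x::metric_space"
  assumes "0 < \<delta>"
  shows "diameter (ball x (\<delta> / 3)) < \<delta>"
proof -
  have "dist y z \<le> 2 * \<delta> / 3" if "y \<in> ball x (\<delta> / 3)" "z \<in> ball x (\<delta> / 3)" for y z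
    using that dist_triangle3[of y z x] by (simp add: dist_commute)
  then have "(SUP (y, z)\<in>ball x (\<delta> / 3) \<times> ball x (\<delta> / 3). dist y z) \<le> 2 * \<delta> / 3"
    using assms by (intro cSUP_least) auto
  then show ?thesis
    using assms by (simp add: diameter_def)
qed

lemma Diam_m_mono: "A \<subseteq> B \<Longrightarrow> Diam_m m A \<le> Diam_m m B"
  unfolding Diam_m_def by (intro SUP_subset_mono) auto

lemma S_m_mono:
  assumes "U \<subseteq> V"
  shows "S_m G \<phi> m U \<le> S_m G \<phi> m V"
  unfolding S_m_def
  by (intro SUP_mono' Limsup_mono always_eventually allI divide_right_mono_ennreal sum_mono
      Diam_m_mono image_mono assms)

section \<open>Right translates of Folner sequences\<close>

context group
begin

lemma inj_on_right_translation:
  assumes "h \<in> carrier G"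
  shows "inj_on (\<lambda>g. g \<otimes> h) (carrier G)"
  using assms by (auto intro: inj_onI)

text \<open>
  Right translation commutes with left multiplication by \<open>K\<close> and preserves
  cardinalities, so the ratios in the Folner condition do not change at all.
\<close>

lemma folner_sequence_right_translate:
  assumes F: "folner_sequence G F" and h: "h \<in> carrier G"
  shows "folner_sequence G (\<lambda>n. (\<lambda>g. g \<otimes> h) ` F n)"
proof -
  have Fn: "F n \<noteq> {}" "finite (F n)" "F n \<subseteq> carrier G" for n
    using F by (auto simp: folner_sequence_def)
  have "(\<lambda>n. real (card (sym_diff ((\<lambda>g. g \<otimes> h) ` F n) (K <#> (\<lambda>g. g \<otimes> h) ` F n)))
          / real (card ((\<lambda>g. g \<otimes> h) ` F n))) \<longlonglongrightarrow> 0"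
    if K: "K \<noteq> {}" "finite K" "K \<subseteq> carrier G" for K
  proof -
    have "card (sym_diff ((\<lambda>g. g \<otimes> h) ` F n) (K <#> (\<lambda>g. g \<otimes> h) ` F n))
            = card (sym_diff (F n) (K <#> F n))"
      and "card ((\<lambda>g. g \<otimes> h) ` F n) = card (F n)" for n
    proof -
      have KF: "K <#> F n \<subseteq> carrier G"
        using K Fn[of n] by (auto simp: set_mult_def)
      have "K <#> (\<lambda>g. g \<otimes> h) ` F n = (\<lambda>g. g \<otimes> h) ` (K <#> F n)"
        using K Fn[of n] h by (force simp: set_mult_def m_assoc subset_iff)
      then have "sym_diff ((\<lambda>g. g \<otimes> h) ` F n) (K <#> (\<lambda>g. g \<otimes> h) ` F n)
                   = (\<lambda>g. g \<otimes> h) ` sym_diff (F n) (K <#> F n)"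
        using inj_on_image_set_diff[OF inj_on_right_translation[OF h], of "F n" "K <#> F n"]
          inj_on_image_set_diff[OF inj_on_right_translation[OF h], of "K <#> F n" "F n"] Fn[of n] KF
        by (auto simp only: image_Un Diff_subset_conv le_supI2)
      then show "card (sym_diff ((\<lambda>g. g \<otimes> h) ` F n) (K <#> (\<lambda>g. g \<otimes> h) ` F n))
                   = card (sym_diff (F n) (K <#> F n))"
        by (simp only:) (rule card_image, rule inj_on_subset[OF inj_on_right_translation[OF h]],
            use Fn[of n] KF in blast)
      show "card ((\<lambda>g. g \<otimes> h) ` F n) = card (F n)"
        using Fn[of n] by (intro card_image inj_on_subset[OF inj_on_right_translation[OF h]])
    qed
    then show ?thesis
      using F K unfolding folner_sequence_def by (simp only:) blast
  qed
  then show ?thesis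
    using Fn h by (auto simp: folner_sequence_def subset_iff)
qed

end

section \<open>The regions where the mean diameter is small\<close>

text \<open>This is the set \<open>W \<epsilon>\<close> of the introduction.\<close>

definition small_S_m_region ::
  "('g, 'b) monoid_scheme \<Rightarrow> ('g \<Rightarrow> 'x::metric_space \<Rightarrow> 'x) \<Rightarrow> nat \<Rightarrow> real \<Rightarrow> 'x set" where
  "small_S_m_region G \<phi> m \<epsilon> = \<Union>{U. open U \<and> S_m G \<phi> m U < ennreal \<epsilon>}"

lemma open_small_S_m_region: "open (small_S_m_region G \<phi> m \<epsilon>)"
  unfolding small_S_m_region_def by auto

text \<open>
  Compactness enters because \<open>diameter\<close> bounds distances only on bounded sets.
\<close>

lemma diam_mean_equicontinuity_point_iff:
  fixes \<phi> :: "'g \<Rightarrow> 'x::metric_space \<Rightarrow> 'x"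
  assumes "compact (UNIV :: 'x set)"
  shows "diam_mean_equicontinuity_point G \<phi> m x \<longleftrightarrow> (\<forall>\<epsilon>>0. x \<in> small_S_m_region G \<phi> m \<epsilon>)"
    (is "?L \<longleftrightarrow> ?R")
proof
  assume L: ?L
  show ?R
  proof (intro allI impI)
    fix \<epsilon> :: real
    assume "\<epsilon> > 0"
    then obtain \<delta> where \<delta>: "\<delta> > 0"
      and small: "\<And>U. open U \<Longrightarrow> x \<in> U \<Longrightarrow> diameter U < \<delta> \<Longrightarrow> S_m G \<phi> m U < ennreal \<epsilon>"
      using L unfolding diam_mean_equicontinuity_point_def by metis
    have "S_m G \<phi> m (ball x (\<delta> / 3)) < ennreal \<epsilon>"
      using \<delta> by (intro small diameter_ball_less) auto
    then show "x \<in> small_S_m_region G \<phi> m \<epsilon>"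
      using \<delta> unfolding small_S_m_region_def
      by (intro UnionI[of "ball x (\<delta> / 3)"]) auto
  qed
next
  assume R: ?R
  show ?L
    unfolding diam_mean_equicontinuity_point_def
  proof (intro allI impI)
    fix \<epsilon> :: real
    assume "\<epsilon> > 0"
    then obtain V where V: "open V" "x \<in> V" "S_m G \<phi> m V < ennreal \<epsilon>"
      using R unfolding small_S_m_region_def by auto
    then obtain \<delta> where \<delta>: "\<delta> > 0" "ball x \<delta> \<subseteq> V"
      by (meson openE)
    have "S_m G \<phi> m U < ennreal \<epsilon>" if U: "x \<in> U" "diameter U < \<delta>" for U
    proof -
      have bdd: "bounded U"
        using assms bounded_subset compact_imp_bounded by blast
      have "U \<subseteq> V"
      proof
        fix y
        assume "y \<in> U"
        then have "dist x y < \<delta>"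
          using diameter_bounded_bound[OF bdd U(1)] U(2) by fastforce
        then show "y \<in> V"
          using \<delta> by auto
      qed
      then show ?thesis
        using S_m_mono V(3) by (metis order_le_less_trans)
    qed
    then show "\<exists>\<delta>>0. \<forall>U. open U \<and> x \<in> U \<and> diameter U < \<delta> \<longrightarrow> S_m G \<phi> m U < ennreal \<epsilon>"
      using \<delta>(1) by auto
  qed
qed

lemma diam_mean_sensitive_iff:
  "diam_mean_sensitive G \<phi> m \<longleftrightarrow> (\<exists>\<epsilon>>0. small_S_m_region G \<phi> m \<epsilon> = {})"
  unfolding diam_mean_sensitive_def small_S_m_region_def
  by (auto simp: not_less[symmetric])

lemma diam_mean_equicontinuity_point_not_sensitive:
  fixes \<phi> :: "'g \<Rightarrow> 'x::metric_space \<Rightarrow> 'x"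
  assumes "compact (UNIV :: 'x set)" and "diam_mean_equicontinuity_point G \<phi> m x"
  shows "\<not> diam_mean_sensitive G \<phi> m"
  using assms(2) unfolding diam_mean_equicontinuity_point_iff[OF assms(1)] diam_mean_sensitive_iff
  by blast

lemma diam_mean_equicontinuous_imp_point:
  assumes "diam_mean_equicontinuous G \<phi> m"
  shows "diam_mean_equicontinuity_point G \<phi> m x"
  using assms unfolding diam_mean_equicontinuous_def diam_mean_equicontinuity_point_def by meson

lemma residual_set_nonempty:
  fixes A :: "'x::metric_space set"
  assumes "compact (UNIV :: 'x set)" and "residual_set A"
  shows "A \<noteq> {}"
proof -
  obtain \<V> where \<V>: "countable \<V>" "\<And>V. V \<in> \<V> \<Longrightarrow> open V \<and> closure V = UNIV" "\<Inter>\<V> \<subseteq> A"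
    using assms(2) unfolding residual_set_def by blast
  have "locally_compact_space (euclidean :: 'x topology)"
    using assms(1) by (intro compact_imp_locally_compact_space) (simp add: compact_space_def)
  moreover have "regular_space (euclidean :: 'x topology)"
    by (simp add: metrizable_imp_regular_space metrizable_space_euclidean)
  ultimately have "euclidean closure_of \<Inter>\<V> = (UNIV :: 'x set)"
    using Baire_category[of "euclidean :: 'x topology" \<V>] \<V> by simp
  then show ?thesis
    using \<V>(3) by auto
qed

section \<open>Invariance and the dichotomies\<close>

context tds
begin

text \<open>
  Averaging over \<open>F n\<close> for the set \<open>hU\<close> is averaging over \<open>F n h\<close> for the set \<open>U\<close>, and
  the latter is one of the averages of which \<open>S_m U\<close> is the supremum.
\<close>

lemma S_m_translate_le:
  assumes h: "h \<in> carrier G"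
  shows "S_m G \<phi> m (\<phi> h ` U) \<le> S_m G \<phi> m U"
  unfolding S_m_def
proof (rule SUP_least)
  fix F
  assume "F \<in> {F. folner_sequence G F}"
  then have F: "folner_sequence G F"
    by simp
  interpret group G
    by (rule group_hom[THEN group_hom.axioms(1)])
  let ?F' = "\<lambda>n. (\<lambda>g. g \<otimes> h) ` F n"
  have "(\<Sum>g\<in>F n. Diam_m m (\<phi> g ` \<phi> h ` U)) / of_nat (card (F n))
          = (\<Sum>g\<in>?F' n. Diam_m m (\<phi> g ` U)) / of_nat (card (?F' n))" for n
  proof -
    have Fn: "F n \<subseteq> carrier G"
      using F by (auto simp: folner_sequence_def)
    then have inj: "inj_on (\<lambda>g. g \<otimes> h) (F n)"
      by (rule inj_on_subset[OF inj_on_right_translation[OF h]])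
    have "\<phi> g ` \<phi> h ` U = \<phi> (g \<otimes> h) ` U" if "g \<in> F n" for g
      using that Fn h composition_rule by (auto simp: image_image subset_iff)
    then show ?thesis
      by (simp add: sum.reindex[OF inj] card_image[OF inj])
  qed
  then show "limsup (\<lambda>n. (\<Sum>g\<in>F n. Diam_m m (\<phi> g ` \<phi> h ` U)) / of_nat (card (F n)))
      \<le> (SUP F\<in>{F. folner_sequence G F}.
            limsup (\<lambda>n. (\<Sum>g\<in>F n. Diam_m m (\<phi> g ` U)) / of_nat (card (F n))))"
    using folner_sequence_right_translate[OF F h] by (simp only:) (intro SUP_upper, simp)
qed

lemma small_S_m_region_invariant:
  assumes h: "h \<in> carrier G" and x: "x \<in> small_S_m_region G \<phi> m \<epsilon>"
  shows "\<phi> h x \<in> small_S_m_region G \<phi> m \<epsilon>"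
proof -
  obtain U where U: "open U" "x \<in> U" "S_m G \<phi> m U < ennreal \<epsilon>"
    using x unfolding small_S_m_region_def by auto
  have "open (\<phi> h ` U)"
    using homeomorphism_imp_open_map[OF homeomorphism_action[OF h], of U] U(1) by simp
  moreover have "S_m G \<phi> m (\<phi> h ` U) < ennreal \<epsilon>"
    using S_m_translate_le[OF h] U(3) by (rule le_less_trans)
  ultimately show ?thesis
    using U(2) unfolding small_S_m_region_def by blast
qed

lemma dense_orbit_subset_open_invariant:
  assumes dense: "closure (orbit G \<phi> x) = UNIV"
    and W: "open W" "W \<noteq> {}" "\<And>h y. h \<in> carrier G \<Longrightarrow> y \<in> W \<Longrightarrow> \<phi> h y \<in> W"
  shows "orbit G \<phi> x \<subseteq> W"
proof -
  obtain y where y: "y \<in> orbit G \<phi> x" "y \<in> W"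
    using open_Int_closure_eq_empty[OF W(1), of "orbit G \<phi> x"] dense W(2) by auto
  show ?thesis
  proof
    fix z
    assume "z \<in> orbit G \<phi> x"
    then have "z \<in> orbit G \<phi> y"
      using orbit_trans[of y x z] orbit_sym[of x y] y(1) by simp
    then show "z \<in> W"
      using W(3) y(2) by (auto simp: orbit_def)
  qed
qed

lemma small_S_m_region_contains_dense_orbit:
  assumes "closure (orbit G \<phi> x) = UNIV" and "\<not> diam_mean_sensitive G \<phi> m" and "\<epsilon> > 0"
  shows "orbit G \<phi> x \<subseteq> small_S_m_region G \<phi> m \<epsilon>"
  using assms small_S_m_region_invariant open_small_S_m_region
  by (intro dense_orbit_subset_open_invariant) (auto simp: diam_mean_sensitive_iff)

theorem transitive_not_sensitive_imp_almost_equicontinuous: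
  assumes "tds_transitive G \<phi>" and "\<not> diam_mean_sensitive G \<phi> m"
  shows "almost_diam_mean_equicontinuous G \<phi> m"
proof -
  obtain x where x: "closure (orbit G \<phi> x) = UNIV"
    using assms(1) unfolding tds_transitive_def by blast
  let ?W = "\<lambda>n. small_S_m_region G \<phi> m (1 / Suc n)"
  have "closure (?W n) = UNIV" for n
    using closure_mono[OF small_S_m_region_contains_dense_orbit[OF x assms(2), of "1 / Suc n"]] x
    by auto
  moreover have "(\<Inter>n. ?W n) \<subseteq> {x. diam_mean_equicontinuity_point G \<phi> m x}"
  proof (clarsimp simp: diam_mean_equicontinuity_point_iff[OF compact_space])
    fix y and \<epsilon> :: real
    assume y: "\<forall>n. y \<in> small_S_m_region G \<phi> m (1 / (1 + real n))" and "\<epsilon> > 0"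
    then obtain n where "1 / Suc n < \<epsilon>"
      using nat_approx_posE by blast
    then have "ennreal (1 / Suc n) \<le> ennreal \<epsilon>"
      by (intro ennreal_leI) simp
    then have "?W n \<subseteq> small_S_m_region G \<phi> m \<epsilon>"
      unfolding small_S_m_region_def
      by (intro Union_mono Collect_mono) (auto elim: order_less_le_trans)
    then show "y \<in> small_S_m_region G \<phi> m \<epsilon>"
      using y by auto
  qed
  ultimately show ?thesis
    unfolding almost_diam_mean_equicontinuous_def residual_set_def
    by (intro exI[of _ "range ?W"]) (auto simp: open_small_S_m_region)
qed

theorem minimal_not_sensitive_imp_equicontinuous:
  assumes "tds_minimal G \<phi>" and "\<not> diam_mean_sensitive G \<phi> m"
  shows "diam_mean_equicontinuous G \<phi> m"
  unfolding diam_mean_equicontinuous_def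
proof (intro allI impI)
  fix \<epsilon> :: real
  assume \<epsilon>: "\<epsilon> > 0"
  let ?C = "{U. open U \<and> S_m G \<phi> m U < ennreal \<epsilon>}"
  have "x \<in> \<Union>?C" for x
  proof -
    have "closure (orbit G \<phi> x) = UNIV"
      using assms(1) by (simp add: tds_minimal_def)
    from small_S_m_region_contains_dense_orbit[OF this assms(2) \<epsilon>]
    show ?thesis
      using orbit_refl[of x] by (simp only: small_S_m_region_def) (rule subsetD, auto)
  qed
  then have cover: "UNIV \<subseteq> \<Union>?C"
    by (rule subsetI)
  then have "?C \<noteq> {}"
    by force
  then obtain \<delta> where "\<delta> > 0" "\<And>U. diameter U < \<delta> \<Longrightarrow> \<exists>V\<in>?C. U \<subseteq> V"
    using Lebesgue_number_lemma[OF compact_space _ cover] by (metis (lifting) mem_Collect_eq subset_UNIV)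
  moreover have "S_m G \<phi> m U < ennreal \<epsilon>" if "\<exists>V\<in>?C. U \<subseteq> V" for U
    using that by (auto intro: order_le_less_trans[OF S_m_mono])
  ultimately show "\<exists>\<delta>>0. \<forall>U. diameter U < \<delta> \<longrightarrow> S_m G \<phi> m U < ennreal \<epsilon>"
    by blast
qed

lemma almost_equicontinuous_not_sensitive:
  assumes "almost_diam_mean_equicontinuous G \<phi> m"
  shows "\<not> diam_mean_sensitive G \<phi> m"
proof -
  obtain x where "diam_mean_equicontinuity_point G \<phi> m x"
    using residual_set_nonempty[OF compact_space] assms
    unfolding almost_diam_mean_equicontinuous_def by fast
  then show ?thesis
    by (rule diam_mean_equicontinuity_point_not_sensitive[OF compact_space])
qed

end

theorem theorem1p1:
  fixes G :: "('g, 'b) monoid_scheme"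
    and \<phi> :: "'g \<Rightarrow> 'x::metric_space \<Rightarrow> 'x"
    and m :: nat
  assumes "tds G \<phi>"
    and "m \<ge> 1"
  shows "(tds_transitive G \<phi> \<longrightarrow>
            (almost_diam_mean_equicontinuous G \<phi> m \<and> \<not> diam_mean_sensitive G \<phi> m) \<or>
            (\<not> almost_diam_mean_equicontinuous G \<phi> m \<and> diam_mean_sensitive G \<phi> m)) \<and>
         (tds_minimal G \<phi> \<longrightarrow>
            (diam_mean_equicontinuous G \<phi> m \<and> \<not> diam_mean_sensitive G \<phi> m) \<or>
            (\<not> diam_mean_equicontinuous G \<phi> m \<and> diam_mean_sensitive G \<phi> m))"
proof -
  interpret tds G \<phi>
    by (fact assms(1))
  have "diam_mean_sensitive G \<phi> m \<longleftrightarrow> \<not> almost_diam_mean_equicontinuous G \<phi> m"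
    if "tds_transitive G \<phi>"
    using transitive_not_sensitive_imp_almost_equicontinuous[OF that, of m]
      almost_equicontinuous_not_sensitive[of m] by argo
  moreover have "diam_mean_sensitive G \<phi> m \<longleftrightarrow> \<not> diam_mean_equicontinuous G \<phi> m"
    if "tds_minimal G \<phi>"
    using minimal_not_sensitive_imp_equicontinuous[OF that, of m]
      diam_mean_equicontinuity_point_not_sensitive[OF compact_space,
        OF diam_mean_equicontinuous_imp_point, of G \<phi> m] by argo
  ultimately show ?thesis
    by argo
qed

end
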